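(* Suppose $f$ has a unique global maximum point $\mu$, of type $k$ and strength $\lambda$. Then, as $N\to\infty$, under $P_N$ the random variable $\bar S_k(\sigma)=\dfrac{S_N(\sigma)-N\mu}{N^{1-1/(2k)}}$ converges in distribution to: - the centered Gaussian law with variance $(-\lambda)^{-1}-J^{-1}$ if $k=1$, and moreover $(-\lambda)^{-1}-J^{-1}>0$ in this case; - the probability law with density proportional to $\exp\big(\frac{\lambda}{(2k)!}x^{2k}\big)$ if $k>1$.
   Context: Let $\rho$ be a non-degenerate Borel probability measure on $\mathbb{R}$ such that $\int_{\mathbb{R}}\exp\big(\tfrac{a x^2}{2}+bx\big)\,d\rho(x)<\infty$ for all $a>0$, $b\in\mathbb{R}$. Fix $J>0$ and $h\in\mathbb{R}$. For $N\ge1$ and $\sigma=(\sigma_1,\dots,\sigma_N)\in\mathbb{R}^N$ let $H_N(\sigma)=-\frac{J}{2N}\sum_{i,j=1}^N\sigma_i\sigma_j-h\sum_{i=1}^N\sigma_i$, and let $P_N$ be the probability measure on $\mathbb{R}^N$ given by $dP_N(\sigma)=Z_N^{-1}\exp(-H_N(\sigma))\prod_{i=1}^N d\rho(\sigma_i)$, where $Z_N$ is the normalizing constant. Let $S_N(\sigma)=\sum_{i=1}^N\sigma_i$ and $m_N(\sigma)=S_N(\sigma)/N$. Define $f(x)=-\frac{J}{2}x^2+\ln\int_{\mathbb{R}}\exp\big(s(Jx+h)\big)\,d\rho(s)$. For a global maximum point $\mu$ of $f$, its type is the positive integer $k$ and its strength is the negative real $\lambda$ such that $f^{(j)}(\mu)=0$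 for $1\le j\le 2k-1$ and $f^{(2k)}(\mu)=\lambda<0$. *)

theory Defs
  imports "HOL-Probability.Probability"
begin

text \<open>Curie-Weiss type model with single-spin distribution rho.
Configurations sigma in R^N are represented as functions nat => real on the
index set {..<N} (elements of the product measure space PiM {..<N} (\<lambda>_. rho)).\<close>

definition cw_H :: "real \<Rightarrow> real \<Rightarrow> nat \<Rightarrow> (nat \<Rightarrow> real) \<Rightarrow> real" where
  "cw_H J h N \<sigma> = - (J / (2 * real N)) * (\<Sum>i<N. \<Sum>j<N. \<sigma> i * \<sigma> j) - h * (\<Sum>i<N. \<sigma> i)"

definition cw_S :: "nat \<Rightarrow> (nat \<Rightarrow> real) \<Rightarrow> real" where
  "cw_S N \<sigma> = (\<Sum>i<N. \<sigma> i)"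

definition cw_Z :: "real measure \<Rightarrow> real \<Rightarrow> real \<Rightarrow> nat \<Rightarrow> real" where
  "cw_Z \<rho> J h N = (\<integral>\<sigma>. exp (- cw_H J h N \<sigma>) \<partial>(PiM {..<N} (\<lambda>_. \<rho>)))"

definition cw_P :: "real measure \<Rightarrow> real \<Rightarrow> real \<Rightarrow> nat \<Rightarrow> (nat \<Rightarrow> real) measure" where
  "cw_P \<rho> J h N = density (PiM {..<N} (\<lambda>_. \<rho>))
      (\<lambda>\<sigma>. ennreal (exp (- cw_H J h N \<sigma>) / cw_Z \<rho> J h N))"

definition cw_f :: "real measure \<Rightarrow> real \<Rightarrow> real \<Rightarrow> real \<Rightarrow> real" where
  "cw_f \<rho> J h x = - (J / 2) * x\<^sup>2 + ln (\<integral>s. exp (s * (J * x + h)) \<partial>\<rho>)"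

definition cw_law :: "real measure \<Rightarrow> real \<Rightarrow> real \<Rightarrow> real \<Rightarrow> nat \<Rightarrow> nat \<Rightarrow> real measure" where
  "cw_law \<rho> J h \<mu> k N = distr (cw_P \<rho> J h N) borel
      (\<lambda>\<sigma>. (cw_S N \<sigma> - real N * \<mu>) / real N powr (1 - 1 / (2 * real k)))"

definition cw_limit_law :: "real \<Rightarrow> nat \<Rightarrow> real measure" where
  "cw_limit_law lam k = density lborel
      (\<lambda>x. ennreal (exp (lam / fact (2 * k) * x ^ (2 * k))
                    / (\<integral>y. exp (lam / fact (2 * k) * y ^ (2 * k)) \<partial>lborel)))"

end

theory Submission
  imports Defs
begin

text \<open>Hubbard-Stratonovich: adding to \<open>S\<^sub>N\<close> an independent Gaussian of variance \<open>N / J\<close> decouples the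
  spins, so that with \<open>a = N powr (1 / (2 k))\<close> the smoothed rescaled sum has density proportional to
  \<open>exp (N (f (\<mu> + x / a) - f \<mu>))\<close>.  Taylor expansion at the maximum gives the pointwise limit
  \<open>exp (lam x ^ (2 k) / (2 k)!)\<close>; near \<open>\<mu>\<close> this expansion, and away from \<open>\<mu>\<close> the quadratic decay of \<open>f\<close>,
  provide a Gaussian majorant for dominated convergence.  The characteristic function of the added
  noise is an explicit factor, which is divided out: it tends to 1 if \<open>k > 1\<close> and reduces the
  variance by \<open>1 / J\<close> if \<open>k = 1\<close>.\<close>

section \<open>Elementary estimates for integrals and the exponential\<close>

lemma integral_pos_of_pos:
  fixes f :: "'a \<Rightarrow> real"
  assumes f: "integrable M f" and pos: "\<And>x. 0 < f x" and M: "emeasure M (space M) \<noteq> 0"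
  shows "0 < integral\<^sup>L M f"
proof -
  have "integral\<^sup>L M f \<noteq> 0"
  proof
    assume "integral\<^sup>L M f = 0"
    then have "AE x in M. f x = 0"
      using integral_nonneg_eq_0_iff_AE[OF f] pos by (simp add: less_imp_le)
    then have "AE x in M. False"
      using pos by (auto simp: less_le)
    then show False
      using M by (auto simp: eventually_ae_filter null_sets_def emeasure_eq_0)
  qed
  moreover have "0 \<le> integral\<^sup>L M f"
    using pos by (intro integral_nonneg_AE) (simp add: less_imp_le)
  ultimately show ?thesis by simp
qed

text \<open>Serves as the uniform bound on difference quotients of the exponential when
  differentiating under the integral sign.\<close>

lemma abs_exp_minus_one_le: "\<bar>exp z - 1\<bar> \<le> \<bar>z\<bar> * exp \<bar>z\<bar>" for z :: real
proof (cases "0 \<le> z")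
  case True
  have "(1 - z) * exp z \<le> exp (- z) * exp z"
    using exp_ge_add_one_self[of "- z"] by (intro mult_right_mono) auto
  then have "exp z - 1 \<le> z * exp z"
    by (simp add: exp_minus field_simps)
  then show ?thesis using True by simp
next
  case False
  have "1 - exp z \<le> \<bar>z\<bar>" using exp_ge_add_one_self[of z] False by linarith
  also have "\<dots> \<le> \<bar>z\<bar> * exp \<bar>z\<bar>" by (simp add: mult_le_cancel_left1)
  finally show ?thesis using False by simp
qed

section \<open>Gaussian integrals\<close>

lemma exp_eq_normal_density:
  fixes c :: real
  assumes "0 < c"
  shows "exp (- c * (x - m)\<^sup>2) = sqrt (pi / c) * normal_density m (1 / sqrt (2 * c)) x"
proof -
  have "(1 / sqrt (2 * c))\<^sup>2 = 1 / (2 * c)"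
    using assms by (simp add: power_divide)
  then show ?thesis
    using assms by (simp add: normal_density_def real_sqrt_divide)
qed

lemma integrable_gaussian:
  fixes c :: real
  assumes "0 < c"
  shows "integrable lborel (\<lambda>x. exp (- c * (x - m)\<^sup>2))"
  unfolding exp_eq_normal_density[OF assms]
  using assms by (intro integrable_mult_right integrable_normal_density) simp

text \<open>The substitution \<open>x = m + s * y\<close>, with \<open>s\<close> the standard
  deviation of this Gaussian, turns the integral into the characteristic function of the standard
  normal law; the shift by \<open>m\<close> only contributes a phase.\<close>

lemma integral_iexp_gaussian:
  fixes c m t :: real
  assumes c: "0 < c"
  shows "(CLBINT x. iexp (t * x) * complex_of_real (exp (- c * (x - m)\<^sup>2)))
    = complex_of_real (sqrt (pi / c) * exp (- t\<^sup>2 / (4 * c))) * iexp (t * m)"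
proof -
  define s where "s = 1 / sqrt (2 * c)"
  have s: "0 < s" "s\<^sup>2 = 1 / (2 * c)"
    using c by (simp_all add: s_def power_divide)
  have gauss: "exp (- c * (s * x)\<^sup>2) = sqrt (2 * pi) * std_normal_density x" for x
    using c by (simp add: std_normal_density_def power_mult_distrib s(2))
  have "(CLBINT x. iexp (t * x) * complex_of_real (exp (- c * (x - m)\<^sup>2)))
     = s *\<^sub>R (CLBINT x. iexp (t * (m + s * x)) * complex_of_real (exp (- c * (m + s * x - m)\<^sup>2)))"
    using s(1) by (subst lborel_integral_real_affine[where c=s and t=m]) simp_all
  also have "(\<lambda>x. iexp (t * (m + s * x)) * complex_of_real (exp (- c * (m + s * x - m)\<^sup>2)))
     = (\<lambda>x. (complex_of_real (sqrt (2 * pi)) * iexp (t * m)) * (std_normal_density x *\<^sub>R iexp ((t * s) * x)))"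
    unfolding add_diff_cancel_left' gauss
    by (rule ext) (simp add: scaleR_conv_of_real ring_distribs exp_add mult_ac)
  also have "(CLBINT x. (complex_of_real (sqrt (2 * pi)) * iexp (t * m)) * (std_normal_density x *\<^sub>R iexp ((t * s) * x)))
      = complex_of_real (sqrt (2 * pi)) * iexp (t * m) * char std_normal_distribution (t * s)"
    by (subst integral_mult_right_zero) (simp add: char_def integral_density)
  also have "char std_normal_distribution (t * s) = complex_of_real (exp (- t\<^sup>2 / (4 * c)))"
    unfolding char_std_normal_distribution by (simp add: power_mult_distrib s(2))
  finally show ?thesis
    using c by (simp add: scaleR_conv_of_real s_def real_sqrt_divide real_sqrt_mult mult_ac)
qed

lemma char_normal:
  assumes s: "0 < s"
  shows "char (density lborel (normal_density 0 s)) t = complex_of_real (exp (- (s * t)\<^sup>2 / 2))"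
proof -
  define c where "c = 1 / (2 * s\<^sup>2)"
  have c: "0 < c" "1 / sqrt (2 * c) = s"
    using s by (simp_all add: c_def real_sqrt_divide)
  have "char (density lborel (normal_density 0 s)) t = (CLBINT x. normal_density 0 s x *\<^sub>R iexp (t * x))"
    by (simp add: char_def integral_density)
  also have "\<dots> = (CLBINT x. complex_of_real (1 / sqrt (pi / c)) * (iexp (t * x) * complex_of_real (exp (- c * (x - 0)\<^sup>2))))"
    unfolding exp_eq_normal_density[OF c(1)] c(2)
    using c by (intro Bochner_Integration.integral_cong) (simp_all add: scaleR_conv_of_real)
  also have "\<dots> = complex_of_real (exp (- t\<^sup>2 / (4 * c)))"
    using c(1) by (subst integral_mult_right_zero, subst integral_iexp_gaussian) simp_all
  also have "- t\<^sup>2 / (4 * c) = - (s * t)\<^sup>2 / 2"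
    by (simp add: c_def power_mult_distrib)
  finally show ?thesis .
qed

section \<open>Behaviour of a function near and away from its maximum\<close>

text \<open>Maclaurin's formula with Lagrange remainder leaves only the constant term and the
  remainder. Its intermediate point is squeezed to 0 together with \<open>y\<close>, and the
  derivative of order \<open>n\<close>, being differentiable, is continuous there.\<close>

lemma taylor_first_nonvanishing:
  fixes f :: "real \<Rightarrow> real"
  assumes smooth: "\<And>m x. ((deriv ^^ m) f has_real_derivative (deriv ^^ Suc m) f x) (at x)"
    and vanish: "\<And>j. 0 < j \<Longrightarrow> j < n \<Longrightarrow> (deriv ^^ j) f \<mu> = 0" and n: "0 < n"
  shows "((\<lambda>y. (f (\<mu> + y) - f \<mu>) / y ^ n) \<longlongrightarrow> (deriv ^^ n) f \<mu> / fact n) (at 0)"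
proof -
  define D where "D m y = (deriv ^^ m) f (\<mu> + y)" for m y
  have D: "(D m has_real_derivative D (Suc m) x) (at x)" for m x
    unfolding D_def using smooth[of m "\<mu> + x"]
    by (subst (asm) add.commute, subst (asm) DERIV_shift) (simp add: add.commute)
  have ex: "\<exists>t. \<bar>t\<bar> \<le> \<bar>y\<bar> \<and> D 0 y = D 0 0 + (D n t / fact n) * y ^ n" for y
  proof -
    obtain t where t: "\<bar>t\<bar> \<le> \<bar>y\<bar>" "D 0 y = (\<Sum>m<n. (D m 0 / fact m) * y ^ m) + (D n t / fact n) * y ^ n"
      using Maclaurin_all_le[of D "D 0" y n] D by auto
    have "(\<Sum>m<n. (D m 0 / fact m) * y ^ m) = (\<Sum>m\<in>{0}. (D m 0 / fact m) * y ^ m)"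
      using n by (intro sum.mono_neutral_right) (auto simp: D_def vanish)
    then show ?thesis using t by auto
  qed
  then obtain T where T: "\<And>y. \<bar>T y\<bar> \<le> \<bar>y\<bar>" "\<And>y. D 0 y = D 0 0 + (D n (T y) / fact n) * y ^ n"
    by metis
  have "((\<lambda>y. \<bar>y\<bar>) \<longlongrightarrow> 0) (at (0::real))"
    by (rule tendsto_rabs_zero) simp
  then have T0: "(T \<longlongrightarrow> 0) (at 0)"
    by (rule Lim_null_comparison[rotated]) (simp add: T(1) eventuallyI)
  have "isCont (D n) 0" using D by (rule DERIV_isCont)
  then have "((\<lambda>y. D n (T y) / fact n) \<longlongrightarrow> D n 0 / fact n) (at 0)"
    by (intro tendsto_divide tendsto_const isCont_tendsto_compose[OF _ T0]) simp_all
  moreover have "eventually (\<lambda>y. D n (T y) / fact n = (f (\<mu> + y) - f \<mu>) / y ^ n) (at 0)"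
    unfolding eventually_at using T(2) by (intro exI[of _ 1]) (auto simp: D_def)
  ultimately show ?thesis
    by (subst (asm) tendsto_cong) (auto simp: D_def)
qed

text \<open>Three regions are treated separately: near 0 the limit of the quotient gives decay of
  order \<open>y ^ n\<close>, on a compact annulus \<open>g\<close> stays below a negative constant,
  and far out \<open>growth\<close> gives quadratic decay. The minimum of the two powers is a rate
  valid in all of them.\<close>

lemma max_decay_bound:
  fixes g :: "real \<Rightarrow> real"
  assumes cont: "continuous_on UNIV g"
    and neg: "\<And>y. y \<noteq> 0 \<Longrightarrow> g y < 0" and g0: "g 0 = 0"
    and lim: "((\<lambda>y. g y / y ^ n) \<longlongrightarrow> l) (at 0)" and l: "l < 0" and n: "even n"
    and growth: "\<And>y. g y \<le> A - B * y\<^sup>2" and B: "0 < B"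
  obtains c where "0 < c" "\<And>y. g y \<le> - c * min (y\<^sup>2) (y ^ n)"
proof -
  have "eventually (\<lambda>y. g y / y ^ n < l / 2) (at 0)"
    using lim l by (intro order_tendstoD(2)) auto
  then obtain d where d: "0 < d" "\<And>y. y \<noteq> 0 \<Longrightarrow> \<bar>y\<bar> < d \<Longrightarrow> g y / y ^ n < l / 2"
    by (auto simp: eventually_at)
  \<comment> \<open>Beyond this radius \<open>y\<^sup>2\<close> exceeds
    \<open>2 * \<bar>A\<bar> / B\<close>, so half of the quadratic term absorbs \<open>A\<close>.
    The summand 1 ensures that \<open>y\<^sup>2\<close> is at least \<open>R\<close> there, and
    \<open>d\<close> makes the annulus nonempty.\<close>
  define R where "R = 1 + d + 2 * \<bar>A\<bar> / B"
  have R: "1 \<le> R" "d \<le> R" "2 * \<bar>A\<bar> / B \<le> R" using d B by (simp_all add: R_def)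
  define K where "K = cball 0 R - ball (0::real) d"
  have "compact K" "R \<in> K" unfolding K_def using R d by (auto intro: compact_diff)
  then obtain z where z: "z \<in> K" "\<And>y. y \<in> K \<Longrightarrow> g y \<le> g z"
    using continuous_attains_sup[of K g] continuous_on_subset[OF cont] by blast
  have gz: "g z < 0" using z(1) d by (intro neg) (auto simp: K_def)
  \<comment> \<open>One admissible rate for each region: near 0, far away, and on the annulus, where
    \<open>y\<^sup>2\<close> is at most \<open>R\<^sup>2\<close>.\<close>
  define c where "c = Min {- l / 2, B / 2, - g z / R\<^sup>2}"
  have c: "0 < c" "c \<le> - l / 2" "c \<le> B / 2" "c \<le> - g z / R\<^sup>2"
  proof -
    have "0 < - g z / R\<^sup>2" using gz R by (intro divide_pos_pos) auto
    then show "0 < c" unfolding c_def using l B by simp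
  qed (unfold c_def, (rule Min_le; simp)+)
  have pn: "0 \<le> y ^ n" for y :: real using n by (simp add: zero_le_even_power)
  have "g y \<le> - c * min (y\<^sup>2) (y ^ n)" for y
  proof -
    consider "y = 0" | "y \<noteq> 0" "\<bar>y\<bar> < d" | "d \<le> \<bar>y\<bar>" "\<bar>y\<bar> \<le> R" | "R < \<bar>y\<bar>" by linarith
    then show ?thesis
    proof cases
      case 1
      then have "min (y\<^sup>2) (y ^ n) = 0" using pn[of y] by (simp add: min.absorb1)
      then show ?thesis using g0 1 by simp
    next
      case 2
      then have "0 < y ^ n" using n by (simp add: zero_less_power_eq)
      with d(2)[OF 2] have "g y \<le> l / 2 * y ^ n" by (simp only: divide_less_eq if_True less_imp_le)
      also have "\<dots> \<le> - c * y ^ n" using c pn[of y] by (intro mult_right_mono) auto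
      also have "\<dots> \<le> - c * min (y\<^sup>2) (y ^ n)" using c by (simp add: mult_left_mono)
      finally show ?thesis .
    next
      case 3
      then have "g y \<le> g z" by (intro z) (auto simp: K_def)
      also have "\<dots> \<le> - c * R\<^sup>2" using c(4) R by (simp add: field_simps)
      also have "\<dots> \<le> - c * y\<^sup>2"
        using c 3 by (simp add: abs_le_square_iff[symmetric] mult_left_mono)
      also have "\<dots> \<le> - c * min (y\<^sup>2) (y ^ n)" using c by (simp add: mult_left_mono)
      finally show ?thesis .
    next
      case 4
      have "R \<le> y\<^sup>2"
        using 4 R mult_mono[of 1 "\<bar>y\<bar>" R "\<bar>y\<bar>"] by (simp add: power2_eq_square flip: abs_mult)
      then have "2 * \<bar>A\<bar> / B \<le> y\<^sup>2" using R by linarith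
      then have "A \<le> B / 2 * y\<^sup>2" using B by (simp add: field_simps)
      then have "g y \<le> - (B / 2) * y\<^sup>2" using growth[of y] by linarith
      also have "\<dots> \<le> - c * y\<^sup>2" using c by (intro mult_right_mono) auto
      also have "\<dots> \<le> - c * min (y\<^sup>2) (y ^ n)" using c by (simp add: mult_left_mono)
      finally show ?thesis .
    qed
  qed
  with c(1) show ?thesis by (rule that)
qed

section \<open>Smoothness and growth of the free energy\<close>

locale cw_spin = prob_space \<rho> for \<rho> :: "real measure" +
  fixes J h :: real
  assumes sets_rho [measurable_cong]: "sets \<rho> = sets borel"
    and moment: "\<And>a b. 0 < a \<Longrightarrow> integrable \<rho> (\<lambda>x. exp (a * x\<^sup>2 / 2 + b * x))"
    and J_pos: "0 < J"
begin

lemma space_rho [simp]: "space \<rho> = UNIV"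
  using sets_eq_imp_space_eq[OF sets_rho] by simp

lemma emeasure_rho_UNIV [simp]: "emeasure \<rho> UNIV = 1"
  using emeasure_space_1 by simp

text \<open>\<open>mom 0\<close> is the moment generating function of \<open>\<rho>\<close>, and
  \<open>mom n\<close> is its derivative of order \<open>n\<close>.\<close>

definition mom :: "nat \<Rightarrow> real \<Rightarrow> real" where
  "mom n x = (\<integral>s. s ^ n * exp (s * x) \<partial>\<rho>)"

lemma integrable_exp_linear: "integrable \<rho> (\<lambda>s. exp (s * x))"
  by (rule Bochner_Integration.integrable_bound[OF moment[of 1 x]]) (auto simp: mult.commute)

text \<open>A power is bounded by a single term of the exponential series:
  \<open>\<bar>s\<bar> ^ n\<close> is at most \<open>fact n * exp \<bar>s\<bar>\<close>. The factor
  \<open>exp \<bar>s\<bar>\<close> is then absorbed by moving \<open>x\<close> one unit to either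
  side.\<close>

lemma integrable_mom: "integrable \<rho> (\<lambda>s. s ^ n * exp (s * x))"
proof (rule Bochner_Integration.integrable_bound)
  show "integrable \<rho> (\<lambda>s. fact n * (exp (s * (x + 1)) + exp (s * (x - 1))))"
    by (intro integrable_mult_right Bochner_Integration.integrable_add integrable_exp_linear)
  have "\<bar>s ^ n * exp (s * x)\<bar> \<le> fact n * (exp (s * (x + 1)) + exp (s * (x - 1)))" for s
  proof -
    have "(\<Sum>i\<in>{n}. \<bar>s\<bar> ^ i /\<^sub>R fact i) \<le> exp \<bar>s\<bar>"
      unfolding exp_def by (intro sum_le_suminf summable_exp_generic) auto
    then have "\<bar>s\<bar> ^ n / fact n \<le> exp \<bar>s\<bar>"
      by (simp add: divide_inverse mult.commute)
    then have "\<bar>s\<bar> ^ n \<le> fact n * exp \<bar>s\<bar>" by (simp add: field_simps)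
    also have "exp \<bar>s\<bar> \<le> exp s + exp (- s)" by (cases "0 \<le> s") auto
    finally have "\<bar>s\<bar> ^ n * exp (s * x) \<le> fact n * (exp s + exp (- s)) * exp (s * x)"
      by (simp add: mult_right_mono)
    also have "\<dots> = fact n * (exp (s * (x + 1)) + exp (s * (x - 1)))"
      by (simp add: ring_distribs exp_add exp_diff exp_minus field_simps)
    finally show ?thesis by (simp add: abs_mult power_abs)
  qed
  then show "AE s in \<rho>. norm (s ^ n * exp (s * x)) \<le> norm (fact n * (exp (s * (x + 1)) + exp (s * (x - 1))))"
    by (intro AE_I2) (smt (verit) real_norm_def)
qed measurable

lemma mom_0_pos: "0 < mom 0 x"
  unfolding mom_def using integrable_mom[of 0 x]
  by (intro integral_pos_of_pos) auto

text \<open>Differentiation under the integral sign, by dominated convergence along an arbitrary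
  sequence of nonzero increments tending to 0.\<close>

lemma DERIV_mom: "(mom n has_real_derivative mom (Suc n) x) (at x)"
  unfolding DERIV_def tendsto_at_iff_sequentially
proof (intro allI impI)
  fix X :: "nat \<Rightarrow> real"
  assume X: "\<forall>i. X i \<in> UNIV - {0}" and X0: "X \<longlonglongrightarrow> 0"
  \<comment> \<open>Dropping finitely many terms bounds the increments by 1, so that one majorant
    serves for all of them.\<close>
  obtain N where N: "\<And>i. N \<le> i \<Longrightarrow> \<bar>X i\<bar> \<le> 1"
    using LIMSEQ_D[OF X0, of 1] by (metis diff_zero less_imp_le real_norm_def zero_less_one)
  define Y where "Y i = X (i + N)" for i
  have Y: "Y i \<noteq> 0" "\<bar>Y i\<bar> \<le> 1" for i using X N[of "i + N"] by (auto simp: Y_def)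
  have Y0: "Y \<longlonglongrightarrow> 0" unfolding Y_def by (rule LIMSEQ_ignore_initial_segment[OF X0])
  \<comment> \<open>With increments of size at most 1 the difference quotient of the exponential is
    at most \<open>\<bar>s\<bar> * exp \<bar>s\<bar>\<close>, and \<open>exp \<bar>s\<bar>\<close>
    is at most \<open>exp s + exp (- s)\<close>; this produces the two shifted moments.\<close>
  define w where "w s = \<bar>s ^ Suc n * exp (s * (x + 1))\<bar> + \<bar>s ^ Suc n * exp (s * (x - 1))\<bar>" for s
  have "(\<lambda>i. \<integral>s. s ^ n * exp (s * x) * ((exp (s * Y i) - 1) / Y i) \<partial>\<rho>)
    \<longlonglongrightarrow> (\<integral>s. s ^ Suc n * exp (s * x) \<partial>\<rho>)"
  proof (rule integral_dominated_convergence[where w=w])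
    show "integrable \<rho> w"
      unfolding w_def by (intro Bochner_Integration.integrable_add integrable_abs integrable_mom)
    have "(\<lambda>i. s ^ n * exp (s * x) * ((exp (s * Y i) - 1) / Y i)) \<longlonglongrightarrow> s ^ Suc n * exp (s * x)" for s
    proof -
      have "((\<lambda>u. exp (s * u)) has_real_derivative s) (at 0)"
        by (auto intro!: derivative_eq_intros)
      then have "((\<lambda>u. (exp (s * u) - 1) / u) \<longlongrightarrow> s) (at 0)"
        by (simp add: DERIV_def)
      then have "(\<lambda>i. (exp (s * Y i) - 1) / Y i) \<longlonglongrightarrow> s"
        using Y Y0 unfolding tendsto_at_iff_sequentially by (auto simp: comp_def)
      then have "(\<lambda>i. s ^ n * exp (s * x) * ((exp (s * Y i) - 1) / Y i)) \<longlonglongrightarrow> s ^ n * exp (s * x) * s"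
        by (intro tendsto_mult tendsto_const)
      then show ?thesis by (simp add: mult_ac)
    qed
    then show "AE s in \<rho>. (\<lambda>i. s ^ n * exp (s * x) * ((exp (s * Y i) - 1) / Y i)) \<longlonglongrightarrow> s ^ Suc n * exp (s * x)"
      by simp
    have "\<bar>s ^ n * exp (s * x) * ((exp (s * Y i) - 1) / Y i)\<bar> \<le> w s" for s i
    proof -
      have "\<bar>exp (s * Y i) - 1\<bar> \<le> \<bar>s * Y i\<bar> * exp \<bar>s * Y i\<bar>" by (rule abs_exp_minus_one_le)
      also have "\<dots> \<le> \<bar>s * Y i\<bar> * exp \<bar>s\<bar>"
        using Y(2)[of i] by (intro mult_left_mono) (auto simp: abs_mult mult_left_le)
      finally have "\<bar>(exp (s * Y i) - 1) / Y i\<bar> \<le> \<bar>s\<bar> * exp \<bar>s\<bar>"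
        using Y(1)[of i] by (simp add: abs_mult field_simps)
      also have "\<dots> \<le> \<bar>s\<bar> * (exp s + exp (- s))"
        by (intro mult_left_mono) (auto simp: abs_if)
      finally have "\<bar>s ^ n * exp (s * x)\<bar> * \<bar>(exp (s * Y i) - 1) / Y i\<bar> \<le> \<bar>s ^ n * exp (s * x)\<bar> * (\<bar>s\<bar> * (exp s + exp (- s)))"
        by (intro mult_left_mono) auto
      also have "\<dots> = w s"
        by (simp add: w_def abs_mult ring_distribs exp_add exp_diff exp_minus field_simps)
      finally show ?thesis by (simp only: abs_mult)
    qed
    then show "AE s in \<rho>. norm (s ^ n * exp (s * x) * ((exp (s * Y i) - 1) / Y i)) \<le> w s" for i
      by simp
  qed measurable
  moreover have "(\<integral>s. s ^ n * exp (s * x) * ((exp (s * Y i) - 1) / Y i) \<partial>\<rho>) = (mom n (x + Y i) - mom n x) / Y i" for i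
  proof -
    have "(\<integral>s. s ^ n * exp (s * x) * ((exp (s * Y i) - 1) / Y i) \<partial>\<rho>)
      = (\<integral>s. (s ^ n * exp (s * (x + Y i)) - s ^ n * exp (s * x)) / Y i \<partial>\<rho>)"
      by (intro Bochner_Integration.integral_cong) (simp_all add: exp_add field_simps)
    then show ?thesis
      by (simp add: mom_def Bochner_Integration.integral_diff[OF integrable_mom integrable_mom])
  qed
  ultimately have "(\<lambda>i. (mom n (x + X (i + N)) - mom n x) / X (i + N)) \<longlonglongrightarrow> mom (Suc n) x"
    by (simp only: Y_def mom_def)
  then show "((\<lambda>u. (mom n (x + u) - mom n x) / u) \<circ> X) \<longlonglongrightarrow> mom (Suc n) x"
    unfolding comp_def by (rule LIMSEQ_offset)
qed

lemma DERIV_mom_affine: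
  "((\<lambda>x. mom n (J * x + h)) has_real_derivative J * mom (Suc n) (J * x + h)) (at x)"
  by (rule DERIV_cong[OF DERIV_chain2[OF DERIV_mom]]) (auto intro!: derivative_eq_intros)

text \<open>An algebra closed under differentiation that contains the derivative of \<open>f\<close>; hence \<open>f\<close> is
  smooth.\<close>

inductive_set mom_algebra :: "(real \<Rightarrow> real) set" where
  ident: "(\<lambda>x. x) \<in> mom_algebra"
| const: "(\<lambda>x. c) \<in> mom_algebra"
| mom: "(\<lambda>x. mom n (J * x + h)) \<in> mom_algebra"
| inv: "(\<lambda>x. inverse (mom 0 (J * x + h))) \<in> mom_algebra"
| add: "u \<in> mom_algebra \<Longrightarrow> v \<in> mom_algebra \<Longrightarrow> (\<lambda>x. u x + v x) \<in> mom_algebra"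
| mult: "u \<in> mom_algebra \<Longrightarrow> v \<in> mom_algebra \<Longrightarrow> (\<lambda>x. u x * v x) \<in> mom_algebra"

lemma mom_algebra_DERIV:
  assumes "u \<in> mom_algebra"
  shows "\<exists>u'\<in>mom_algebra. \<forall>x. (u has_real_derivative u' x) (at x)"
  using assms
proof induction
  case ident
  show ?case by (intro bexI[OF _ mom_algebra.const[of 1]]) auto
next
  case (const c)
  show ?case by (intro bexI[OF _ mom_algebra.const[of 0]]) auto
next
  case (mom n)
  show ?case
    using DERIV_mom_affine
    by (intro bexI[OF _ mom_algebra.mult[OF mom_algebra.const[of J] mom_algebra.mom[of "Suc n"]]]) auto
next
  case inv
  have "((\<lambda>x. inverse (mom 0 (J * x + h))) has_real_derivative
     - J * (mom 1 (J * x + h) * (inverse (mom 0 (J * x + h)) * inverse (mom 0 (J * x + h))))) (at x)" for x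
    by (rule DERIV_cong[OF DERIV_inverse_fun[OF DERIV_mom_affine[of 0]]])
      (use mom_0_pos[of "J * x + h"] in \<open>auto simp: power2_eq_square\<close>)
  then show ?case
    by (intro bexI[OF _ mom_algebra.mult[OF mom_algebra.const[of "- J"]
      mom_algebra.mult[OF mom_algebra.mom[of 1] mom_algebra.mult[OF mom_algebra.inv mom_algebra.inv]]]]) auto
next
  case (add u v)
  then obtain u' v' where "u' \<in> mom_algebra" "v' \<in> mom_algebra"
    "\<forall>x. (u has_real_derivative u' x) (at x)" "\<forall>x. (v has_real_derivative v' x) (at x)" by blast
  then show ?case
    by (intro bexI[OF _ mom_algebra.add[of u' v']]) (auto intro!: DERIV_add)
next
  case (mult u v)
  then obtain u' v' where "u' \<in> mom_algebra" "v' \<in> mom_algebra"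
    "\<forall>x. (u has_real_derivative u' x) (at x)" "\<forall>x. (v has_real_derivative v' x) (at x)" by blast
  then show ?case using mult.hyps
    by (intro bexI[OF _ mom_algebra.add[OF mom_algebra.mult[of u' v] mom_algebra.mult[of v' u]]])
      (auto intro!: DERIV_mult)
qed

lemma mom_algebra_deriv:
  assumes "u \<in> mom_algebra"
  shows "deriv u \<in> mom_algebra" "(u has_real_derivative deriv u x) (at x)"
proof -
  obtain u' where u': "u' \<in> mom_algebra" "\<And>x. (u has_real_derivative u' x) (at x)"
    using mom_algebra_DERIV[OF assms] by blast
  then have "deriv u = u'" by (intro ext DERIV_imp_deriv)
  with u' show "deriv u \<in> mom_algebra" "(u has_real_derivative deriv u x) (at x)" by auto
qed

lemma mom_algebra_higher_deriv: "u \<in> mom_algebra \<Longrightarrow> (deriv ^^ n) u \<in> mom_algebra"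
  by (induction n) (simp_all add: mom_algebra_deriv)

lemma cw_f_eq: "cw_f \<rho> J h x = - (J / 2) * x\<^sup>2 + ln (mom 0 (J * x + h))"
  by (simp add: cw_f_def mom_def)

lemma DERIV_cw_f:
  "(cw_f \<rho> J h has_real_derivative - J * x + J * (mom 1 (J * x + h) * inverse (mom 0 (J * x + h)))) (at x)"
proof -
  have "((\<lambda>x. - (J / 2) * x\<^sup>2 + ln (mom 0 (J * x + h))) has_real_derivative
      - J * x + J * (mom 1 (J * x + h) * inverse (mom 0 (J * x + h)))) (at x)"
  proof (rule DERIV_add)
    show "((\<lambda>x. - (J / 2) * x\<^sup>2) has_real_derivative - J * x) (at x)"
      by (auto intro!: derivative_eq_intros)
    show "((\<lambda>x. ln (mom 0 (J * x + h))) has_real_derivative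
        J * (mom 1 (J * x + h) * inverse (mom 0 (J * x + h)))) (at x)"
      using DERIV_chain2[OF DERIV_ln[OF mom_0_pos] DERIV_mom_affine[of 0 x]] by (simp add: mult_ac)
  qed
  then show ?thesis unfolding cw_f_eq[abs_def] .
qed

lemma deriv_cw_f:
  "deriv (cw_f \<rho> J h) = (\<lambda>x. - J * x + J * (mom 1 (J * x + h) * inverse (mom 0 (J * x + h))))"
  using DERIV_cw_f by (intro ext DERIV_imp_deriv)

text \<open>The logarithm in \<open>f\<close> is not among the generators of
  \<open>mom_algebra\<close>, so order 0 is handled directly; from the first derivative on, the
  logarithm has become a quotient that lies in the algebra.\<close>

lemma smooth_cw_f:
  "((deriv ^^ n) (cw_f \<rho> J h) has_real_derivative (deriv ^^ Suc n) (cw_f \<rho> J h) x) (at x)"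
proof (cases n)
  case 0
  then show ?thesis using DERIV_cw_f by (simp add: deriv_cw_f)
next
  case (Suc m)
  have "deriv (cw_f \<rho> J h) \<in> mom_algebra"
    unfolding deriv_cw_f by (intro mom_algebra.intros)
  then have "(deriv ^^ n) (cw_f \<rho> J h) \<in> mom_algebra"
    using mom_algebra_higher_deriv by (simp add: Suc funpow_Suc_right del: funpow.simps)
  then show ?thesis using mom_algebra_deriv(2) by simp
qed

text \<open>The second derivative is \<open>- J\<close> plus \<open>J\<^sup>2\<close> times the
  variance of \<open>\<rho>\<close> tilted by \<open>exp (s * (J * x + h))\<close>, and a
  non-degenerate law has positive variance under any such tilt. At the maximum with
  \<open>k = 1\<close> this makes the limiting variance positive.\<close>

lemma deriv2_cw_f_gt:
  assumes nondeg: "\<And>c. measure \<rho> {c} \<noteq> 1"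
  shows "- J < deriv (deriv (cw_f \<rho> J h)) x"
proof -
  define m where "m n = mom n (J * x + h)" for n
  have m0: "0 < m 0" unfolding m_def by (rule mom_0_pos)
  \<comment> \<open>The mean of the tilted law; \<open>g\<close> then integrates to
    \<open>m 0\<close> times the tilted variance.\<close>
  define r where "r = m 1 / m 0"
  define g where "g s = (s - r)\<^sup>2 * exp (s * (J * x + h))" for s
  have g_eq: "g = (\<lambda>s. s ^ 2 * exp (s * (J * x + h)) - 2 * r * (s ^ 1 * exp (s * (J * x + h))) + r\<^sup>2 * (s ^ 0 * exp (s * (J * x + h))))"
    by (auto simp: g_def power2_diff algebra_simps)
  have ig: "integrable \<rho> g"
    unfolding g_eq by (intro Bochner_Integration.integrable_add Bochner_Integration.integrable_diff
        integrable_mult_right integrable_mom)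
  have "integral\<^sup>L \<rho> g = m 2 - 2 * r * m 1 + r\<^sup>2 * m 0"
    unfolding g_eq m_def mom_def
    using integrable_mom[of _ "J * x + h"]
    by (simp only: Bochner_Integration.integral_add Bochner_Integration.integral_diff
        Bochner_Integration.integrable_diff integrable_mult_right integral_mult_right_zero)
  also have "\<dots> = m 2 - m 1 * m 1 / m 0"
    using m0 by (simp add: r_def power2_eq_square)
  finally have int_g: "integral\<^sup>L \<rho> g = m 2 - m 1 * m 1 / m 0" .
  have "integral\<^sup>L \<rho> g \<noteq> 0"
  proof
    assume "integral\<^sup>L \<rho> g = 0"
    then have "AE s in \<rho>. g s = 0"
      by (subst (asm) integral_nonneg_eq_0_iff_AE[OF ig]) (auto simp: g_def)
    then have "AE s in \<rho>. s \<in> {r}" by (simp add: g_def)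
    then have "measure \<rho> {r} = 1" by (intro prob_eq_1[THEN iffD2]) (auto simp: sets_rho)
    then show False using nondeg by blast
  qed
  moreover have "0 \<le> integral\<^sup>L \<rho> g" by (intro integral_nonneg_AE) (simp add: g_def)
  ultimately have pos: "0 < m 2 - m 1 * m 1 / m 0" using int_g by simp
  have "((\<lambda>x. - J * x + J * (mom 1 (J * x + h) * inverse (mom 0 (J * x + h)))) has_real_derivative
    - J + J * (J * m 2 * inverse (m 0) - m 1 * (J * m 1 * inverse (m 0) * inverse (m 0)))) (at x)"
  proof -
    have "((\<lambda>x. mom 1 (J * x + h) * inverse (mom 0 (J * x + h))) has_real_derivative
        J * m 2 * inverse (m 0) + - (J * m 1 * inverse (m 0 ^ Suc (Suc 0))) * m 1) (at x)"
      unfolding m_def using DERIV_mult[OF DERIV_mom_affine[of 1 x] DERIV_inverse_fun[OF DERIV_mom_affine[of 0 x]]] mom_0_pos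
      by (simp add: numeral_2_eq_2 less_imp_neq[symmetric])
    then have "((\<lambda>x. - J * x + J * (mom 1 (J * x + h) * inverse (mom 0 (J * x + h)))) has_real_derivative
        - J * 1 + J * (J * m 2 * inverse (m 0) + - (J * m 1 * inverse (m 0 ^ Suc (Suc 0))) * m 1)) (at x)"
      by (intro DERIV_add DERIV_cmult DERIV_ident)
    then show ?thesis by (simp add: mult_ac)
  qed
  then have "deriv (deriv (cw_f \<rho> J h)) x =
    - J + J * (J * m 2 * inverse (m 0) - m 1 * (J * m 1 * inverse (m 0) * inverse (m 0)))"
    unfolding deriv_cw_f by (rule DERIV_imp_deriv)
  also have "\<dots> = - J + J\<^sup>2 * inverse (m 0) * (m 2 - m 1 * m 1 / m 0)"
    using m0 by (simp add: divide_inverse algebra_simps power2_eq_square)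
  also have "- J < \<dots>"
    using mult_pos_pos[OF mult_pos_pos[of "J\<^sup>2" "inverse (m 0)"] pos] m0 J_pos by simp
  finally show ?thesis .
qed

text \<open>Since \<open>J * (x / 2 - s)\<^sup>2\<close> is nonnegative, \<open>J * s * x\<close> is
  at most \<open>J / 4 * x\<^sup>2 + J * s\<^sup>2\<close>. This costs half of the term
  \<open>- (J / 2) * x\<^sup>2\<close>, and the rest is a finite quadratic exponential
  moment.\<close>

lemma cw_f_upper_bound: "cw_f \<rho> J h x \<le> - (J / 4) * x\<^sup>2 + ln (\<integral>s. exp (J * s\<^sup>2 + h * s) \<partial>\<rho>)"
proof -
  let ?K = "\<integral>s. exp (J * s\<^sup>2 + h * s) \<partial>\<rho>"
  have i: "integrable \<rho> (\<lambda>s. exp (J * s\<^sup>2 + h * s))"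
    using moment[of "2 * J" h] J_pos by simp
  have K: "0 < ?K"
    using i by (intro integral_pos_of_pos) auto
  have "mom 0 (J * x + h) \<le> (\<integral>s. exp (J / 4 * x\<^sup>2) * exp (J * s\<^sup>2 + h * s) \<partial>\<rho>)"
    unfolding mom_def
  proof (rule integral_mono[OF integrable_mom integrable_mult_right[OF i]])
    fix s
    have "0 \<le> J * (x / 2 - s)\<^sup>2" using J_pos by simp
    then show "s ^ 0 * exp (s * (J * x + h)) \<le> exp (J / 4 * x\<^sup>2) * exp (J * s\<^sup>2 + h * s)"
      by (simp add: power2_eq_square algebra_simps flip: exp_add)
  qed
  then have "ln (mom 0 (J * x + h)) \<le> ln (exp (J / 4 * x\<^sup>2) * ?K)"
    using mom_0_pos K by (subst ln_le_cancel_iff) auto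
  also have "\<dots> = J / 4 * x\<^sup>2 + ln ?K"
    using K by (simp add: ln_mult)
  finally show ?thesis unfolding cw_f_eq by (simp add: field_simps)
qed

section \<open>The Gibbs measure and the Hubbard-Stratonovich transform\<close>

sublocale spins: product_sigma_finite "\<lambda>_::nat. \<rho>"
  by standard

lemma measurable_cw_S [measurable]: "cw_S N \<in> borel_measurable (PiM {..<N} (\<lambda>_. \<rho>))"
  unfolding cw_S_def[abs_def] by measurable

lemma cw_H_eq: "cw_H J h N \<sigma> = - (J / (2 * real N) * (cw_S N \<sigma>)\<^sup>2 + h * cw_S N \<sigma>)"
  by (simp add: cw_H_def cw_S_def power2_eq_square sum_product)

lemma minus_cw_H: "- cw_H J h N \<sigma> = J / (2 * real N) * (cw_S N \<sigma>)\<^sup>2 + h * cw_S N \<sigma>"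
  by (simp add: cw_H_eq)

lemma measurable_cw_H [measurable]: "cw_H J h N \<in> borel_measurable (PiM {..<N} (\<lambda>_. \<rho>))"
  unfolding cw_H_eq[abs_def] by measurable

lemma prob_space_spins: "prob_space (PiM {..<N} (\<lambda>_. \<rho>))"
  by (intro prob_space_PiM prob_space_axioms)

text \<open>By Cauchy-Schwarz the mean-field interaction is at most the sum of the single-spin
  energies, so the Gibbs weight is dominated by a product.\<close>

lemma integrable_gibbs: "integrable (PiM {..<N} (\<lambda>_. \<rho>)) (\<lambda>\<sigma>. exp (- cw_H J h N \<sigma>))"
proof (rule Bochner_Integration.integrable_bound)
  show "integrable (PiM {..<N} (\<lambda>_. \<rho>)) (\<lambda>\<sigma>. \<Prod>i<N. exp (J * (\<sigma> i)\<^sup>2 / 2 + h * \<sigma> i))"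
    by (intro spins.product_integrable_prod moment J_pos) simp
  have "- cw_H J h N \<sigma> \<le> (\<Sum>i<N. J * (\<sigma> i)\<^sup>2 / 2 + h * \<sigma> i)" for \<sigma>
  proof (cases "N = 0")
    case False
    have "(cw_S N \<sigma>)\<^sup>2 \<le> (\<Sum>i<N. (\<sigma> i)\<^sup>2) * real N"
      unfolding cw_S_def using sum_squared_le_sum_of_squares[of \<sigma> "{..<N}"] by simp
    then have "J / (2 * real N) * (cw_S N \<sigma>)\<^sup>2 \<le> J / (2 * real N) * ((\<Sum>i<N. (\<sigma> i)\<^sup>2) * real N)"
      using J_pos by (intro mult_left_mono) auto
    also have "\<dots> = (\<Sum>i<N. J * (\<sigma> i)\<^sup>2 / 2)"
      using False by (simp add: sum_divide_distrib[symmetric] sum_distrib_left[symmetric])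
    finally show ?thesis
      unfolding minus_cw_H by (simp add: sum.distrib cw_S_def sum_distrib_left)
  qed (simp add: cw_H_def)
  then show "AE \<sigma> in PiM {..<N} (\<lambda>_. \<rho>). norm (exp (- cw_H J h N \<sigma>)) \<le> norm (\<Prod>i<N. exp (J * (\<sigma> i)\<^sup>2 / 2 + h * \<sigma> i))"
    by (intro AE_I2) (simp flip: exp_sum)
qed measurable

lemma cw_Z_pos: "0 < cw_Z \<rho> J h N"
  unfolding cw_Z_def
  using prob_space.emeasure_space_1[OF prob_space_spins, of N]
  by (intro integral_pos_of_pos integrable_gibbs) simp_all

lemma prob_space_cw_P: "prob_space (cw_P \<rho> J h N)"
proof
  have "emeasure (cw_P \<rho> J h N) (space (cw_P \<rho> J h N))
    = (\<integral>\<^sup>+\<sigma>. ennreal (exp (- cw_H J h N \<sigma>) / cw_Z \<rho> J h N) \<partial>PiM {..<N} (\<lambda>_. \<rho>))"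
    unfolding cw_P_def
    by (simp add: emeasure_density space_density cong: nn_integral_cong)
  also have "\<dots> = ennreal (\<integral>\<sigma>. exp (- cw_H J h N \<sigma>) / cw_Z \<rho> J h N \<partial>PiM {..<N} (\<lambda>_. \<rho>))"
    using cw_Z_pos by (intro nn_integral_eq_integral integrable_divide integrable_gibbs) (auto simp: less_imp_le)
  also have "\<dots> = 1"
    using cw_Z_pos[of N] by (simp add: cw_Z_def[symmetric])
  finally show "emeasure (cw_P \<rho> J h N) (space (cw_P \<rho> J h N)) = 1" .
qed

text \<open>Levy's continuity theorem asks for a distribution at every index, including
  \<open>N = 0\<close>, where the Gibbs measure lives on the one-point configuration space.\<close>

lemma real_distribution_cw_law: "real_distribution (cw_law \<rho> J h \<mu> k N)"
  unfolding cw_law_def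
  by (rule prob_space.real_distribution_distr[OF prob_space_cw_P])
    (simp add: cw_P_def)

text \<open>For fixed \<open>v\<close> the exponent is linear in the spins, so the integral over the
  product measure factors into \<open>N\<close> copies of the moment generating function at
  \<open>J * v + h\<close>.\<close>

lemma exp_cw_f_eq_integral:
  "exp (real N * cw_f \<rho> J h v)
    = (\<integral>\<sigma>. exp (- (real N * J / 2) * v\<^sup>2 + cw_S N \<sigma> * (J * v + h)) \<partial>PiM {..<N} (\<lambda>_. \<rho>))"
proof -
  have "(\<integral>\<sigma>. exp (- (real N * J / 2) * v\<^sup>2 + cw_S N \<sigma> * (J * v + h)) \<partial>PiM {..<N} (\<lambda>_. \<rho>))
    = (\<integral>\<sigma>. exp (- (real N * J / 2) * v\<^sup>2) * (\<Prod>i<N. exp (\<sigma> i * (J * v + h))) \<partial>PiM {..<N} (\<lambda>_. \<rho>))"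
    by (simp only: exp_add cw_S_def sum_distrib_right exp_sum[OF finite_lessThan])
  also have "\<dots> = exp (- (real N * J / 2) * v\<^sup>2) * mom 0 (J * v + h) ^ N"
    using spins.product_integral_prod[of "{..<N}" "\<lambda>_ s. exp (s * (J * v + h))"] integrable_exp_linear
    by (simp add: mom_def)
  also have "\<dots> = exp (real N * cw_f \<rho> J h v)"
  proof -
    have "mom 0 (J * v + h) ^ N = exp (real N * ln (mom 0 (J * v + h)))"
      by (simp add: exp_of_nat_mult mom_0_pos)
    moreover have "real N * cw_f \<rho> J h v = - (real N * J / 2) * v\<^sup>2 + real N * ln (mom 0 (J * v + h))"
      by (simp add: cw_f_eq algebra_simps)
    ultimately show ?thesis by (simp only: exp_add)
  qed
  finally show ?thesis by simp
qed

text \<open>The Hubbard-Stratonovich identity: completing the square in \<open>x\<close> turns the Gibbs weight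
  times a Gaussian into a product weight, whose integral over the spins is \<open>exp (N f)\<close>.\<close>

lemma hubbard_stratonovich:
  fixes \<mu> a t :: real
  assumes N: "0 < N" and a: "0 < a"
  defines "c \<equiv> real N * J / (2 * a\<^sup>2)"
  shows "(CLBINT x. iexp (t * x) * complex_of_real (exp (real N * cw_f \<rho> J h (\<mu> + x / a))))
    = complex_of_real (sqrt (pi / c) * exp (- t\<^sup>2 / (4 * c)))
      * (CLINT \<sigma>|PiM {..<N} (\<lambda>_. \<rho>). complex_of_real (exp (- cw_H J h N \<sigma>)) * iexp (t * (a * (cw_S N \<sigma> / real N - \<mu>))))"
proof -
  have c: "0 < c" using N a J_pos by (simp add: c_def)
  define m where "m \<sigma> = a * (cw_S N \<sigma> / real N - \<mu>)" for \<sigma>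
  have m [measurable]: "m \<in> borel_measurable (PiM {..<N} (\<lambda>_. \<rho>))"
    unfolding m_def by measurable
  define F where "F \<sigma> x = complex_of_real (exp (- cw_H J h N \<sigma>)) * (iexp (t * x) * complex_of_real (exp (- c * (x - m \<sigma>)\<^sup>2)))" for \<sigma> x
  interpret S: prob_space "PiM {..<N} (\<lambda>_. \<rho>)" by (rule prob_space_spins)
  interpret pair_sigma_finite "PiM {..<N} (\<lambda>_. \<rho>)" "lborel :: real measure"
    by standard
  have square: "- (real N * J / 2) * (\<mu> + x / a)\<^sup>2 + cw_S N \<sigma> * (J * (\<mu> + x / a) + h)
      = - cw_H J h N \<sigma> + - c * (x - m \<sigma>)\<^sup>2" for \<sigma> x
    unfolding minus_cw_H c_def m_def using N a by (simp add: field_simps power2_eq_square)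
  have norm_F: "norm (F \<sigma> x) = exp (- cw_H J h N \<sigma>) * exp (- c * (x - m \<sigma>)\<^sup>2)" for \<sigma> x
    by (simp add: F_def norm_mult)
  have gauss: "(\<integral>x. exp (- c * (x - m \<sigma>)\<^sup>2) \<partial>lborel) = sqrt (pi / c)" for \<sigma>
    unfolding exp_eq_normal_density[OF c] using c by (subst integral_mult_right_zero) simp
  have F_meas: "case_prod F \<in> borel_measurable (PiM {..<N} (\<lambda>_. \<rho>) \<Otimes>\<^sub>M lborel)"
    unfolding F_def by measurable
  have F_meas': "F \<sigma> \<in> borel_measurable lborel" for \<sigma>
    unfolding F_def by measurable
  have int_F: "integrable (PiM {..<N} (\<lambda>_. \<rho>) \<Otimes>\<^sub>M lborel) (case_prod F)"
  proof (rule Fubini_integrable[OF F_meas])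
    \<comment> \<open>The Gaussian integral over \<open>x\<close> does not depend on its centre
      \<open>m \<sigma>\<close>, so what remains to be integrated over the spins is a constant
      multiple of the Gibbs weight.\<close>
    have "(\<integral>x. norm (case_prod F (\<sigma>, x)) \<partial>lborel) = exp (- cw_H J h N \<sigma>) * sqrt (pi / c)" for \<sigma>
      by (simp only: prod.case norm_F integral_mult_right_zero gauss)
    then show "integrable (PiM {..<N} (\<lambda>_. \<rho>)) (\<lambda>\<sigma>. \<integral>x. norm (case_prod F (\<sigma>, x)) \<partial>lborel)"
      using integrable_mult_left[OF integrable_gibbs] by simp
    show "AE \<sigma> in PiM {..<N} (\<lambda>_. \<rho>). integrable lborel (\<lambda>x. case_prod F (\<sigma>, x))"
    proof (intro AE_I2)
      fix \<sigma>
      have "integrable lborel (\<lambda>x. norm (F \<sigma> x))"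
        unfolding norm_F by (intro integrable_mult_right integrable_gaussian c)
      then show "integrable lborel (\<lambda>x. case_prod F (\<sigma>, x))"
        using F_meas' by (subst (asm) integrable_norm_iff) simp_all
    qed
  qed
  have "(CLBINT x. iexp (t * x) * complex_of_real (exp (real N * cw_f \<rho> J h (\<mu> + x / a))))
      = (CLBINT x. (CLINT \<sigma>|PiM {..<N} (\<lambda>_. \<rho>). F \<sigma> x))"
  proof (rule Bochner_Integration.integral_cong[OF refl])
    fix x :: real
    have "complex_of_real (exp (real N * cw_f \<rho> J h (\<mu> + x / a)))
        = (CLINT \<sigma>|PiM {..<N} (\<lambda>_. \<rho>). complex_of_real (exp (- cw_H J h N \<sigma>) * exp (- c * (x - m \<sigma>)\<^sup>2)))"
      unfolding exp_cw_f_eq_integral square integral_complex_of_real exp_add ..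
    then show "iexp (t * x) * complex_of_real (exp (real N * cw_f \<rho> J h (\<mu> + x / a)))
        = (CLINT \<sigma>|PiM {..<N} (\<lambda>_. \<rho>). F \<sigma> x)"
      by (simp only: integral_mult_right_zero[symmetric] F_def of_real_mult mult_ac)
  qed
  also have "\<dots> = (CLINT \<sigma>|PiM {..<N} (\<lambda>_. \<rho>). (CLBINT x. F \<sigma> x))"
    by (rule Fubini_integral[OF int_F])
  also have "\<dots> = (CLINT \<sigma>|PiM {..<N} (\<lambda>_. \<rho>). complex_of_real (sqrt (pi / c) * exp (- t\<^sup>2 / (4 * c)))
      * (complex_of_real (exp (- cw_H J h N \<sigma>)) * iexp (t * m \<sigma>)))"
    by (intro Bochner_Integration.integral_cong refl)
      (simp only: F_def integral_mult_right_zero integral_iexp_gaussian[OF c], simp only: mult_ac)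
  finally show ?thesis
    unfolding m_def integral_mult_right_zero .
qed

text \<open>Since \<open>N powr (1 - 1 / (2 k))\<close> equals \<open>N / a\<close>, the rescaled
  sum is exactly the centre of the Gaussian in \<open>hubbard_stratonovich\<close>, and both
  statements involve the same spin integral.\<close>

lemma char_cw_law:
  fixes \<mu> t :: real and k :: nat
  assumes N: "0 < N"
  defines "a \<equiv> real N powr (1 / (2 * real k))"
  shows "char (cw_law \<rho> J h \<mu> k N) t
    = (CLINT \<sigma>|PiM {..<N} (\<lambda>_. \<rho>). complex_of_real (exp (- cw_H J h N \<sigma>)) * iexp (t * (a * (cw_S N \<sigma> / real N - \<mu>))))
      / complex_of_real (cw_Z \<rho> J h N)"
proof -
  have scale: "(cw_S N \<sigma> - real N * \<mu>) / real N powr (1 - 1 / (2 * real k)) = a * (cw_S N \<sigma> / real N - \<mu>)" for \<sigma>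
    using N by (simp add: powr_diff a_def field_simps)
  have "char (cw_law \<rho> J h \<mu> k N) t
    = (CLINT \<sigma>|PiM {..<N} (\<lambda>_. \<rho>). (exp (- cw_H J h N \<sigma>) / cw_Z \<rho> J h N) *\<^sub>R iexp (t * (a * (cw_S N \<sigma> / real N - \<mu>))))"
    unfolding char_def cw_law_def scale
    using cw_Z_pos[of N]
    by (subst integral_distr) (simp_all add: cw_P_def integral_density less_imp_le)
  also have "\<dots> = (CLINT \<sigma>|PiM {..<N} (\<lambda>_. \<rho>). (complex_of_real (exp (- cw_H J h N \<sigma>)) * iexp (t * (a * (cw_S N \<sigma> / real N - \<mu>)))) / complex_of_real (cw_Z \<rho> J h N))"
    by (intro Bochner_Integration.integral_cong) (simp_all add: scaleR_conv_of_real)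
  finally show ?thesis by (simp only: integral_divide_zero)
qed

text \<open>Applying the Hubbard-Stratonovich identity at \<open>t\<close> and at 0 and taking the
  quotient cancels \<open>cw_Z\<close> and all other constants. The exponential factor is the
  reciprocal of the characteristic function of the added noise, whose variance after rescaling is
  \<open>a\<^sup>2 / (N * J)\<close>. Subtracting \<open>f \<mu>\<close> in the exponent changes
  \<open>B\<close> by a constant factor only, but gives \<open>B\<close> a finite nonzero
  limit.\<close>

lemma char_cw_law_eq_ratio:
  fixes \<mu> t :: real and k :: nat
  assumes N: "0 < N"
  defines "a \<equiv> real N powr (1 / (2 * real k))"
  defines "B \<equiv> (\<lambda>t. CLBINT x. iexp (t * x) * complex_of_real (exp (real N * (cw_f \<rho> J h (\<mu> + x / a) - cw_f \<rho> J h \<mu>))))"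
  shows "char (cw_law \<rho> J h \<mu> k N) t = complex_of_real (exp (t\<^sup>2 * a\<^sup>2 / (2 * real N * J))) * (B t / B 0)"
proof -
  have a: "0 < a" using N by (simp add: a_def)
  define c where "c = real N * J / (2 * a\<^sup>2)"
  have c: "0 < c" using N a J_pos by (simp add: c_def)
  define K where "K = complex_of_real (exp (- real N * cw_f \<rho> J h \<mu>) * sqrt (pi / c) * cw_Z \<rho> J h N)"
  have K: "K \<noteq> 0" using c cw_Z_pos[of N] by (simp add: K_def)
  have B: "B t = K * complex_of_real (exp (- t\<^sup>2 / (4 * c))) * char (cw_law \<rho> J h \<mu> k N) t" for t
  proof -
    have "B t = (CLBINT x. complex_of_real (exp (- real N * cw_f \<rho> J h \<mu>)) *
        (iexp (t * x) * complex_of_real (exp (real N * cw_f \<rho> J h (\<mu> + x / a)))))"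
      unfolding B_def by (intro Bochner_Integration.integral_cong)
        (simp_all add: right_diff_distrib exp_diff exp_minus divide_inverse mult_ac)
    then show ?thesis
      unfolding integral_mult_right_zero hubbard_stratonovich[OF N a] char_cw_law[OF N]
      using cw_Z_pos[of N] by (simp add: K_def c_def a_def)
  qed
  have "char (cw_law \<rho> J h \<mu> k N) 0 = 1"
    by (rule real_distribution.char_zero[OF real_distribution_cw_law])
  then have "B t / B 0 = complex_of_real (exp (- t\<^sup>2 / (4 * c))) * char (cw_law \<rho> J h \<mu> k N) t"
    using K by (simp add: B)
  moreover have "t\<^sup>2 * a\<^sup>2 / (2 * real N * J) = t\<^sup>2 / (4 * c)"
    using a N J_pos by (simp add: c_def field_simps)
  ultimately show ?thesis
    by (simp add: exp_minus flip: of_real_mult mult.assoc)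
qed

end

section \<open>Convergence of the characteristic functions\<close>

text \<open>Replaces decay of order \<open>2 * k\<close> by Gaussian decay at the price of a
  constant factor, so that Gaussian majorants suffice for every \<open>k\<close>.\<close>

lemma power2_minus_one_le_even_power:
  fixes x :: real
  assumes "1 \<le> k"
  shows "x\<^sup>2 - 1 \<le> x ^ (2 * k)"
proof (cases "1 \<le> x\<^sup>2")
  case True
  then have "x\<^sup>2 \<le> (x\<^sup>2) ^ k" using assms by (intro self_le_power) auto
  then show ?thesis by (simp add: power_mult)
next
  case False
  moreover have "0 \<le> x ^ (2 * k)" by simp
  ultimately show ?thesis by linarith
qed

lemma integrable_exp_even_power:
  fixes l :: real
  assumes l: "l < 0" and k: "1 \<le> k"
  shows "integrable lborel (\<lambda>x. exp (l * x ^ (2 * k)))"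
proof (rule Bochner_Integration.integrable_bound)
  show "integrable lborel (\<lambda>x. exp (- l) * exp (- (- l) * (x - 0)\<^sup>2))"
    using l by (intro integrable_mult_right integrable_gaussian) simp
  have "l * x ^ (2 * k) \<le> - l + l * x\<^sup>2" for x
    using mult_left_mono_neg[OF power2_minus_one_le_even_power[OF k, of x], of l] l
    by (simp add: algebra_simps)
  then show "AE x in lborel. norm (exp (l * x ^ (2 * k))) \<le> norm (exp (- l) * exp (- (- l) * (x - 0)\<^sup>2))"
    by (simp flip: exp_add)
qed measurable

context cw_spin
begin

lemma cw_f_max_quotient:
  assumes vanish: "\<And>j. j \<in> {1..2*k-1} \<Longrightarrow> (deriv ^^ j) (cw_f \<rho> J h) \<mu> = 0"
    and strength: "(deriv ^^ (2*k)) (cw_f \<rho> J h) \<mu> = lam" and k: "1 \<le> k"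
  shows "((\<lambda>y. (cw_f \<rho> J h (\<mu> + y) - cw_f \<rho> J h \<mu>) / y ^ (2 * k)) \<longlongrightarrow> lam / fact (2 * k)) (at 0)"
  using taylor_first_nonvanishing[OF smooth_cw_f, of "2 * k" \<mu>] assms by auto

lemma cw_f_max_decay:
  assumes max: "\<And>x. x \<noteq> \<mu> \<Longrightarrow> cw_f \<rho> J h x < cw_f \<rho> J h \<mu>"
    and lim: "((\<lambda>y. (cw_f \<rho> J h (\<mu> + y) - cw_f \<rho> J h \<mu>) / y ^ (2 * k)) \<longlongrightarrow> l) (at 0)" and l: "l < 0"
  obtains c where "0 < c" "\<And>y. cw_f \<rho> J h (\<mu> + y) - cw_f \<rho> J h \<mu> \<le> - c * min (y\<^sup>2) (y ^ (2 * k))"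
proof -
  have "isCont (cw_f \<rho> J h) x" for x using DERIV_cw_f by (rule DERIV_isCont)
  then have "continuous_on UNIV (cw_f \<rho> J h)" by (simp add: continuous_at_imp_continuous_on)
  then have "continuous_on UNIV (\<lambda>y. cw_f \<rho> J h (\<mu> + y))"
    by (rule continuous_on_compose2) (auto intro!: continuous_intros)
  then have cont: "continuous_on UNIV (\<lambda>y. cw_f \<rho> J h (\<mu> + y) - cw_f \<rho> J h \<mu>)"
    by (rule continuous_on_diff[OF _ continuous_on_const])
  let ?K = "ln (\<integral>s. exp (J * s\<^sup>2 + h * s) \<partial>\<rho>)"
  have growth: "cw_f \<rho> J h (\<mu> + y) - cw_f \<rho> J h \<mu> \<le> (J / 4 * \<mu>\<^sup>2 + ?K - cw_f \<rho> J h \<mu>) - (J / 8) * y\<^sup>2" for y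
  proof -
    \<comment> \<open>Recentring at \<open>\<mu>\<close> uses up half of the rate
      \<open>J / 4\<close>: \<open>(\<mu> + y)\<^sup>2\<close> is at least
      \<open>y\<^sup>2 / 2 - \<mu>\<^sup>2\<close>.\<close>
    have "0 \<le> J * (2 * \<mu> + y)\<^sup>2" using J_pos by simp
    moreover have "- (J / 4) * (\<mu> + y)\<^sup>2 = J / 4 * \<mu>\<^sup>2 - (J / 8) * y\<^sup>2 - J * (2 * \<mu> + y)\<^sup>2 / 8"
      by (simp add: power2_eq_square algebra_simps)
    ultimately show ?thesis using cw_f_upper_bound[of "\<mu> + y"] by linarith
  qed
  have neg: "cw_f \<rho> J h (\<mu> + y) - cw_f \<rho> J h \<mu> < 0" if "y \<noteq> 0" for y
    using max[of "\<mu> + y"] that by simp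
  show ?thesis
    by (rule max_decay_bound[OF cont neg _ lim l _ growth]) (use J_pos in \<open>simp_all add: that\<close>)
qed

text \<open>Dominated convergence. The scale satisfies \<open>a n ^ (2 * k) = Suc n\<close>, so the
  exponent equals \<open>x ^ (2 * k)\<close> times the quotient in \<open>lim\<close> taken at
  \<open>x / a n\<close>, which tends to 0.\<close>

lemma tendsto_tilted_integral:
  assumes max: "\<And>x. x \<noteq> \<mu> \<Longrightarrow> cw_f \<rho> J h x < cw_f \<rho> J h \<mu>"
    and lim: "((\<lambda>y. (cw_f \<rho> J h (\<mu> + y) - cw_f \<rho> J h \<mu>) / y ^ (2 * k)) \<longlongrightarrow> l) (at 0)"
    and l: "l < 0" and k: "1 \<le> k"
  shows "(\<lambda>n. CLBINT x. iexp (t * x) * complex_of_real (exp (real (Suc n)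
      * (cw_f \<rho> J h (\<mu> + x / real (Suc n) powr (1 / (2 * real k))) - cw_f \<rho> J h \<mu>))))
    \<longlonglongrightarrow> (CLBINT x. iexp (t * x) * complex_of_real (exp (l * x ^ (2 * k))))"
proof -
  define g where "g y = cw_f \<rho> J h (\<mu> + y) - cw_f \<rho> J h \<mu>" for y
  define a where "a n = real (Suc n) powr (1 / (2 * real k))" for n
  obtain c where c: "0 < c" "\<And>y. g y \<le> - c * min (y\<^sup>2) (y ^ (2 * k))"
    using cw_f_max_decay[OF max lim l] unfolding g_def by blast
  have a_pos: "0 < a n" for n by (simp add: a_def)
  have a_power: "a n ^ (2 * k) = real (Suc n)" for n
    using k by (simp add: a_def powr_power)
  have a_square: "(a n)\<^sup>2 \<le> real (Suc n)" for n
  proof -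
    have "(a n)\<^sup>2 = real (Suc n) powr (1 / real k)" by (simp add: a_def powr_power)
    also have "\<dots> \<le> real (Suc n) powr 1" using k by (intro powr_mono) auto
    finally show ?thesis by simp
  qed
  have "(\<lambda>n. real (Suc n) powr - (1 / (2 * real k))) \<longlonglongrightarrow> 0"
    using k by (intro tendsto_neg_powr filterlim_compose[OF filterlim_real_sequentially] filterlim_Suc) auto
  then have a_inf: "(\<lambda>n. inverse (a n)) \<longlonglongrightarrow> 0"
    by (simp only: a_def powr_minus)
  have cont: "isCont (cw_f \<rho> J h) x" for x using DERIV_cw_f by (rule DERIV_isCont)
  then have [measurable]: "cw_f \<rho> J h \<in> borel_measurable borel"
    by (intro borel_measurable_continuous_onI) (simp add: continuous_at_imp_continuous_on)
  have "(\<lambda>n. CLBINT x. iexp (t * x) * complex_of_real (exp (real (Suc n) * g (x / a n))))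
    \<longlonglongrightarrow> (CLBINT x. iexp (t * x) * complex_of_real (exp (l * x ^ (2 * k))))"
  proof (rule integral_dominated_convergence[where w = "\<lambda>x. exp c * exp (- c * (x - 0)\<^sup>2)"])
    show "integrable lborel (\<lambda>x. exp c * exp (- c * (x - 0)\<^sup>2))"
      using c by (intro integrable_mult_right integrable_gaussian) simp
    have "(\<lambda>n. real (Suc n) * g (x / a n)) \<longlonglongrightarrow> l * x ^ (2 * k)" for x
    \<comment> \<open>The limit of the quotient is taken in a punctured neighbourhood of 0, so
      \<open>x = 0\<close> needs its own argument.\<close>
    proof (cases "x = 0")
      case True
      then show ?thesis using k by (simp add: g_def power_0_left)
    next
      case False
      have "(\<lambda>n. x / a n) \<longlonglongrightarrow> 0"
        unfolding divide_inverse by (rule tendsto_mult_right_zero[OF a_inf])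
      moreover have "x / a n \<noteq> 0" for n using False a_pos[of n] by simp
      ultimately have "filterlim (\<lambda>n. x / a n) (at 0) sequentially"
        by (simp add: filterlim_at)
      then have "(\<lambda>n. g (x / a n) / (x / a n) ^ (2 * k)) \<longlonglongrightarrow> l"
        using lim unfolding g_def by (rule filterlim_compose[rotated])
      then have "(\<lambda>n. g (x / a n) / (x / a n) ^ (2 * k) * x ^ (2 * k)) \<longlonglongrightarrow> l * x ^ (2 * k)"
        by (intro tendsto_mult tendsto_const)
      moreover have "g (x / a n) / (x / a n) ^ (2 * k) * x ^ (2 * k) = real (Suc n) * g (x / a n)" for n
        unfolding power_divide a_power using False by simp
      ultimately show ?thesis by simp
    qed
    then have "(\<lambda>n. complex_of_real (exp (real (Suc n) * g (x / a n)))) \<longlonglongrightarrow> complex_of_real (exp (l * x ^ (2 * k)))" for x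
      by (rule tendsto_of_real[OF tendsto_exp])
    then show "AE x in lborel. (\<lambda>n. iexp (t * x) * complex_of_real (exp (real (Suc n) * g (x / a n))))
        \<longlonglongrightarrow> iexp (t * x) * complex_of_real (exp (l * x ^ (2 * k)))"
      by (intro AE_I2 tendsto_mult[OF tendsto_const])
    have "real (Suc n) * g (x / a n) \<le> c - c * x\<^sup>2" for n x
    proof -
      have "x\<^sup>2 \<le> real (Suc n) * (x / a n)\<^sup>2"
        using mult_left_mono[OF a_square[of n], of "x\<^sup>2"] a_pos[of n] by (simp add: power_divide field_simps)
      moreover have "real (Suc n) * (x / a n) ^ (2 * k) = x ^ (2 * k)"
        unfolding power_divide a_power by simp
      \<comment> \<open>Whichever power attains the minimum, multiplication by \<open>Suc n\<close>
        undoes the scaling: the square becomes at least \<open>x\<^sup>2\<close> by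
        \<open>a_square\<close>, the higher power becomes exactly
        \<open>x ^ (2 * k)\<close>.\<close>
      ultimately have "x\<^sup>2 - 1 \<le> real (Suc n) * min ((x / a n)\<^sup>2) ((x / a n) ^ (2 * k))"
        using power2_minus_one_le_even_power[OF k, of x] by (simp add: min_def)
      then have "c * (x\<^sup>2 - 1) \<le> c * (real (Suc n) * min ((x / a n)\<^sup>2) ((x / a n) ^ (2 * k)))"
        using c(1) by (intro mult_left_mono) auto
      moreover have "real (Suc n) * g (x / a n) \<le> real (Suc n) * (- c * min ((x / a n)\<^sup>2) ((x / a n) ^ (2 * k)))"
        by (intro mult_left_mono c(2)) simp
      ultimately show ?thesis by (simp add: algebra_simps)
    qed
    then show "AE x in lborel. norm (iexp (t * x) * complex_of_real (exp (real (Suc n) * g (x / a n))))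
        \<le> exp c * exp (- c * (x - 0)\<^sup>2)" for n
      by (intro AE_I2) (simp add: norm_mult flip: exp_add)
  qed (unfold g_def, measurable)
  then show ?thesis by (simp only: g_def a_def)
qed

lemma tendsto_char_cw_law:
  assumes max: "\<And>x. x \<noteq> \<mu> \<Longrightarrow> cw_f \<rho> J h x < cw_f \<rho> J h \<mu>"
    and lim: "((\<lambda>y. (cw_f \<rho> J h (\<mu> + y) - cw_f \<rho> J h \<mu>) / y ^ (2 * k)) \<longlongrightarrow> l) (at 0)"
    and l: "l < 0" and k: "1 \<le> k"
  shows "(\<lambda>N. char (cw_law \<rho> J h \<mu> k N) t) \<longlonglongrightarrow>
    complex_of_real (exp (t\<^sup>2 * (if k = 1 then 1 else 0) / (2 * J)))
    * ((CLBINT x. iexp (t * x) * complex_of_real (exp (l * x ^ (2 * k))))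
      / complex_of_real (LBINT x. exp (l * x ^ (2 * k))))"
proof -
  have Z: "0 < (LBINT x. exp (l * x ^ (2 * k)))"
    by (intro integral_pos_of_pos integrable_exp_even_power l k) simp_all
  have Z': "(CLBINT x. iexp (0 * x) * complex_of_real (exp (l * x ^ (2 * k))))
      = complex_of_real (LBINT x. exp (l * x ^ (2 * k)))"
    by simp
  \<comment> \<open>The variance of the rescaled noise is \<open>1 / J\<close> times this ratio,
    which equals \<open>Suc n powr (1 / k - 1)\<close>. It is constantly 1 for \<open>k = 1\<close>
    and vanishes in the limit otherwise; this alone separates the two cases of the theorem.\<close>
  have "(\<lambda>n. (real (Suc n) powr (1 / (2 * real k)))\<^sup>2 / real (Suc n)) \<longlonglongrightarrow> (if k = 1 then 1 else 0)"
  proof -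
    have eq: "(real (Suc n) powr (1 / (2 * real k)))\<^sup>2 / real (Suc n) = real (Suc n) powr (1 / real k - 1)" for n
      by (simp add: powr_power powr_diff)
    show ?thesis
    proof (cases "k = 1")
      case False
      then have "(\<lambda>n. real (Suc n) powr (1 / real k - 1)) \<longlonglongrightarrow> 0"
        using k by (intro tendsto_neg_powr filterlim_compose[OF filterlim_real_sequentially] filterlim_Suc) auto
      then show ?thesis using False by (simp only: eq if_False)
    next
      case True
      then show ?thesis unfolding eq by simp
    qed
  qed
  then have "(\<lambda>n. exp (t\<^sup>2 * ((real (Suc n) powr (1 / (2 * real k)))\<^sup>2 / real (Suc n)) / (2 * J)))
      \<longlonglongrightarrow> exp (t\<^sup>2 * (if k = 1 then 1 else 0) / (2 * J))"
    using J_pos by (intro tendsto_intros) auto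
  then have gauss: "(\<lambda>n. exp (t\<^sup>2 * (real (Suc n) powr (1 / (2 * real k)))\<^sup>2 / (2 * real (Suc n) * J)))
      \<longlonglongrightarrow> exp (t\<^sup>2 * (if k = 1 then 1 else 0) / (2 * J))"
    by (simp only: times_divide_eq_right divide_divide_eq_left mult_ac)
  have nz: "(CLBINT x. iexp (0 * x) * complex_of_real (exp (l * x ^ (2 * k)))) \<noteq> 0"
    unfolding Z' using Z by (metis of_real_eq_0_iff less_irrefl)
  note tilted = tendsto_tilted_integral[OF max lim l k]
  have "(\<lambda>n. char (cw_law \<rho> J h \<mu> k (Suc n)) t) \<longlonglongrightarrow>
    complex_of_real (exp (t\<^sup>2 * (if k = 1 then 1 else 0) / (2 * J)))
    * ((CLBINT x. iexp (t * x) * complex_of_real (exp (l * x ^ (2 * k))))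
      / (CLBINT x. iexp (0 * x) * complex_of_real (exp (l * x ^ (2 * k)))))"
    unfolding char_cw_law_eq_ratio[OF zero_less_Suc]
    by (rule tendsto_mult[OF tendsto_of_real[OF gauss] tendsto_divide[OF tilted[of t] tilted[of 0] nz]])
  then show ?thesis
    unfolding Z' by (rule LIMSEQ_imp_Suc)
qed

end

section \<open>The limit law and the conclusion by Levy's continuity theorem\<close>

lemma char_cw_limit_law:
  fixes lam :: real
  assumes lam: "lam < 0" and k: "1 \<le> k"
  shows "real_distribution (cw_limit_law lam k)"
    and "char (cw_limit_law lam k) t = (CLBINT x. iexp (t * x) * complex_of_real (exp (lam / fact (2 * k) * x ^ (2 * k))))
      / complex_of_real (LBINT x. exp (lam / fact (2 * k) * x ^ (2 * k)))"
proof -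
  define l where "l = lam / fact (2 * k)"
  define Z where "Z = (LBINT x. exp (l * x ^ (2 * k)))"
  have l: "l < 0" using lam by (simp add: l_def divide_neg_pos)
  have int: "integrable lborel (\<lambda>x. exp (l * x ^ (2 * k)))"
    by (rule integrable_exp_even_power[OF l k])
  have Z: "0 < Z" unfolding Z_def by (intro integral_pos_of_pos int) simp_all
  have law: "cw_limit_law lam k = density lborel (\<lambda>x. ennreal (exp (l * x ^ (2 * k)) / Z))"
    by (simp add: cw_limit_law_def l_def Z_def)
  have "(\<integral>\<^sup>+x. ennreal (exp (l * x ^ (2 * k)) / Z) \<partial>lborel) = ennreal (LBINT x. exp (l * x ^ (2 * k)) / Z)"
    using Z int by (intro nn_integral_eq_integral) (auto simp: less_imp_le)
  also have "\<dots> = 1" using Z by (simp add: Z_def[symmetric])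
  finally have "prob_space (cw_limit_law lam k)"
    unfolding law by (intro prob_spaceI) (simp add: emeasure_density)
  then show "real_distribution (cw_limit_law lam k)"
    by (simp add: real_distribution_def real_distribution_axioms_def law)
  have "char (cw_limit_law lam k) t = (CLBINT x. (exp (l * x ^ (2 * k)) / Z) *\<^sub>R iexp (t * x))"
    unfolding law char_def using Z by (subst integral_density) (simp_all add: less_imp_le)
  also have "\<dots> = (CLBINT x. iexp (t * x) * complex_of_real (exp (l * x ^ (2 * k))) / complex_of_real Z)"
    by (intro Bochner_Integration.integral_cong) (simp_all add: scaleR_conv_of_real)
  finally show "char (cw_limit_law lam k) t = (CLBINT x. iexp (t * x) * complex_of_real (exp (lam / fact (2 * k) * x ^ (2 * k))))
      / complex_of_real (LBINT x. exp (lam / fact (2 * k) * x ^ (2 * k)))"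
    by (simp only: integral_divide_zero l_def Z_def)
qed

theorem theorem2:
  fixes \<rho> :: "real measure" and J h \<mu> lam :: real and k :: nat
  assumes rho_prob: "prob_space \<rho>"
    and rho_borel: "sets \<rho> = sets borel"
    and rho_nondeg: "\<forall>c. measure \<rho> {c} \<noteq> 1"
    and rho_moment: "\<forall>a>0. \<forall>b. integrable \<rho> (\<lambda>x. exp (a * x\<^sup>2 / 2 + b * x))"
    and J_pos: "J > 0"
    and unique_max: "\<forall>x. x \<noteq> \<mu> \<longrightarrow> cw_f \<rho> J h x < cw_f \<rho> J h \<mu>"
    and k_pos: "k \<ge> 1"
    and type_k: "\<forall>j\<in>{1..2*k-1}. (deriv ^^ j) (cw_f \<rho> J h) \<mu> = 0"
    and strength: "(deriv ^^ (2*k)) (cw_f \<rho> J h) \<mu> = lam"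
    and lambda_neg: "lam < 0"
  shows "(k = 1 \<longrightarrow>
            1 / (- lam) - 1 / J > 0 \<and>
            weak_conv_m (cw_law \<rho> J h \<mu> k)
              (density lborel (normal_density 0 (sqrt (1 / (- lam) - 1 / J)))))
      \<and> (k > 1 \<longrightarrow> weak_conv_m (cw_law \<rho> J h \<mu> k) (cw_limit_law lam k))"
proof -
  interpret prob_space \<rho> by (rule rho_prob)
  interpret cw_spin \<rho> J h
    using rho_borel rho_moment J_pos by unfold_locales auto
  have quot: "((\<lambda>y. (cw_f \<rho> J h (\<mu> + y) - cw_f \<rho> J h \<mu>) / y ^ (2 * k)) \<longlongrightarrow> lam / fact (2 * k)) (at 0)"
    using type_k strength k_pos by (intro cw_f_max_quotient) auto
  have l: "lam / fact (2 * k) < 0" using lambda_neg by (simp add: divide_neg_pos)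
  have max: "cw_f \<rho> J h x < cw_f \<rho> J h \<mu>" if "x \<noteq> \<mu>" for x using unique_max that by blast
  note char_lim = tendsto_char_cw_law[OF max quot l k_pos]
  have "1 / (- lam) - 1 / J > 0 \<and>
      weak_conv_m (cw_law \<rho> J h \<mu> k) (density lborel (normal_density 0 (sqrt (1 / (- lam) - 1 / J))))"
    if k: "k = 1"
  proof
    have "- J < lam"
      using deriv2_cw_f_gt[of \<mu>] rho_nondeg strength by (simp add: k numeral_2_eq_2)
    then show v: "1 / (- lam) - 1 / J > 0"
      using divide_strict_left_mono[of "- lam" J 1] lambda_neg J_pos by (simp add: mult_pos_neg)
    define s where "s = sqrt (1 / (- lam) - 1 / J)"
    have s: "0 < s" "s\<^sup>2 = 1 / (- lam) - 1 / J" using v by (simp_all add: s_def)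
    \<comment> \<open>For \<open>k = 1\<close> the limiting weight is
      \<open>exp (lam / 2 * x\<^sup>2)\<close>, a centred Gaussian of variance
      \<open>1 / (- lam)\<close>.\<close>
    have gauss: "(CLBINT x. iexp (t * x) * complex_of_real (exp (lam / fact (2 * k) * x ^ (2 * k))))
        = complex_of_real (sqrt (pi / (- lam / 2)) * exp (- t\<^sup>2 / (4 * (- lam / 2))))" for t
      using integral_iexp_gaussian[of "- lam / 2" t 0] lambda_neg by (simp add: k)
    have Z: "complex_of_real (LBINT x. exp (lam / fact (2 * k) * x ^ (2 * k))) = complex_of_real (sqrt (pi / (- lam / 2)))"
      using gauss[of 0] by (simp flip: integral_complex_of_real)
    show "weak_conv_m (cw_law \<rho> J h \<mu> k) (density lborel (normal_density 0 (sqrt (1 / (- lam) - 1 / J))))"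
      unfolding s_def[symmetric]
    proof (rule levy_continuity)
      show "real_distribution (density lborel (normal_density 0 s))"
        using prob_space_normal_density[OF s(1)] by (simp add: real_distribution_def real_distribution_axioms_def)
      fix t
      have "complex_of_real (exp (t\<^sup>2 * (if k = 1 then 1 else 0) / (2 * J)))
        * ((CLBINT x. iexp (t * x) * complex_of_real (exp (lam / fact (2 * k) * x ^ (2 * k))))
          / complex_of_real (LBINT x. exp (lam / fact (2 * k) * x ^ (2 * k))))
        = complex_of_real (exp (t\<^sup>2 / (2 * J)) * exp (- t\<^sup>2 / (4 * (- lam / 2))))"
        unfolding gauss Z using lambda_neg k by simp
      \<comment> \<open>Dividing out the noise adds \<open>t\<^sup>2 / (2 * J)\<close> to the
        Gaussian exponent, that is, it subtracts \<open>1 / J\<close> from the variance.\<close>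
      also have "exp (t\<^sup>2 / (2 * J)) * exp (- t\<^sup>2 / (4 * (- lam / 2))) = exp (- (s * t)\<^sup>2 / 2)"
        unfolding exp_add[symmetric] power_mult_distrib s(2)
        using lambda_neg J_pos by (simp add: field_simps)
      finally show "(\<lambda>N. char (cw_law \<rho> J h \<mu> k N) t) \<longlonglongrightarrow> char (density lborel (normal_density 0 s)) t"
        using char_lim[of t] unfolding char_normal[OF s(1)] by simp
    qed (rule real_distribution_cw_law)
  qed
  moreover have "weak_conv_m (cw_law \<rho> J h \<mu> k) (cw_limit_law lam k)" if "k > 1"
  proof (rule levy_continuity)
    show "(\<lambda>N. char (cw_law \<rho> J h \<mu> k N) t) \<longlonglongrightarrow> char (cw_limit_law lam k) t" for t
      using char_lim[of t] that unfolding char_cw_limit_law(2)[OF lambda_neg k_pos] by simp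
  qed (use char_cw_limit_law(1)[OF lambda_neg k_pos] real_distribution_cw_law in auto)
  ultimately show ?thesis by blast
qed

end
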